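(* Let $\mathcal{M}$ be a unitary magma without nontrivial unit divisors and $k\ge0$ be an integer. Then the space $\mathsf{Deg}_k\mathcal{M}=\mathsf{C}\mathcal{M}/\mathfrak{R}_{\mathsf{Deg}_k\mathcal{M}}$ is a quotient operad of $\mathsf{C}\mathcal{M}$ (that is, $\mathfrak{R}_{\mathsf{Deg}_k\mathcal{M}}$ is an operad ideal of $\mathsf{C}\mathcal{M}$).
   Context: Let $\mathbb{K}$ be a field of characteristic zero and $[n]=\{1,\dots,n\}$. A unitary magma is a set $\mathcal{M}$ with a binary operation $\star$ (not assumed associative) having a two-sided unit $\mathbb{1}_{\mathcal{M}}$. It is without nontrivial unit divisors if $a\star b=\mathbb{1}_{\mathcal{M}}$ implies $a=b=\mathbb{1}_{\mathcal{M}}$. Operads are nonsymmetric operads in $\mathbb{K}$-vector spaces (graded from arity $1$, with partial compositions $\circ_i$ and a unit of arity $1$). An operad ideal of $\mathcal{O}$ is a graded subspace $I$ such that $x\circ_i y$ and $y\circ_j x$ are in $I$ for all $x\in\mathcal{O}$, $y\in I$ and valid $i,j$; then $\mathcal{O}/I$ is a quotient operad. An $\mathcal{M}$-clique of arity $n\ge1$ is a map $\mathfrak{p}$ assigning a label $\mathfrak{p}(x,y)\in\mathcal{M}$ to each arc $(x,y)$, $1\le x<y\le n+1$; by convention the only $\mathcal{M}$-clique of arity $1$ is $\mathbf{u}$, with $\mathbf{u}(1,2)=\mathbb{1}_{\mathcal{M}}$. An arc is solid if its label is not $\mathbb{1}_{\mathcal{M}}$. Write $\mathfrak{p}_0:=\mathfrak{p}(1,n+1)$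 and $\mathfrak{p}_i:=\mathfrak{p}(i,i+1)$ for $i\in[n]$. $\mathsf{C}\mathcal{M}$ is the operad (with unit $\mathbf{u}$) such that $\mathsf{C}\mathcal{M}(n)$ has basis the $\mathcal{M}$-cliques of arity $n$, and for $\mathcal{M}$-cliques $\mathfrak{p},\mathfrak{q}$ of arities $n,m$ and $i\in[n]$, $\mathfrak{p}\circ_i\mathfrak{q}$ is the $\mathcal{M}$-clique of arity $n+m-1$ with, for $1\le x<y\le n+m$, $$(\mathfrak{p}\circ_i\mathfrak{q})(x,y)=\begin{cases}\mathfrak{p}(x,y)&\text{if }y\le i,\\ \mathfrak{p}(x,y-m+1)&\text{if }x\le i<i+m\le y,\ (x,y)\ne(i,i+m),\\ \mathfrak{p}(x-m+1,y-m+1)&\text{if }i+m\le x,\\ \mathfrak{q}(x-i+1,y-i+1)&\text{if }i\le x<y\le i+m,\ (x,y)\ne(i,i+m),\\ \mathfrak{p}_i\star\mathfrak{q}_0&\text{if }(x,y)=(i,i+m),\\ \mathbb{1}_{\mathcal{M}}&\text{otherwise}.\end{cases}$$ The skeleton of an $\mathcal{M}$-clique $\mathfrak{p}$ of arity $n$ is the undirected graph on $[n+1]$ with an edge $\{x,y\}$ for each solid arc $(x,y)$ of $\mathfrak{p}$. The degree $\mathrm{degr}(\mathfrak{p})$ is the maximal degree of a vertex of the skeleton. $\mathfrak{R}_{\mathsf{Deg}_k\mathcal{M}}$ is the subspace of $\mathsf{C}\mathcal{M}$ spanned by all $\mathcal{M}$-cliques $\mathfrak{p}$ with $\mathrm{degr}(\mathfrak{p})\ge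 k+1$. *)

theory Defs
  imports "HOL-Algebra.AbelCoset" "HOL-Algebra.Module" "HOL-Library.FuncSet" "HOL.Hull"
begin

section \<open>Nonsymmetric operads in vector spaces\<close>

locale field_char_zero = field K for K (structure) +
  assumes char_zero: "\<And>n::nat. n > 0 \<Longrightarrow> [n] \<cdot> \<one> \<noteq> \<zero>"

text \<open>
  The homogeneous components are \<open>grade P n\<close> for \<open>n \<ge> 1\<close>; the value at \<open>0\<close> is never used.
  \<open>pcomp P n m i x y\<close> is \<open>x \<circ>\<^sub>i y\<close> for \<open>x\<close> of arity \<open>n\<close> and \<open>y\<close> of arity \<open>m\<close>. The arities are
  explicit arguments because the components are not required to be disjoint (they may, for
  instance, share their zero vector).
\<close>

record ('k, 'v) operad_data =
  grade :: "nat \<Rightarrow> ('k, 'v) module"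
  pcomp :: "nat \<Rightarrow> nat \<Rightarrow> nat \<Rightarrow> 'v \<Rightarrow> 'v \<Rightarrow> 'v"
  ounit :: 'v

locale operad = field K for K (structure) +
  fixes P :: "('a, 'v) operad_data"
  assumes grade_module: "n \<ge> 1 \<Longrightarrow> module K (grade P n)"
    and pcomp_closed:
      "\<lbrakk>n \<ge> 1; m \<ge> 1; i \<in> {1..n}; x \<in> carrier (grade P n); y \<in> carrier (grade P m)\<rbrakk>
        \<Longrightarrow> pcomp P n m i x y \<in> carrier (grade P (n + m - 1))"
    and pcomp_add_left:
      "\<lbrakk>n \<ge> 1; m \<ge> 1; i \<in> {1..n}; x \<in> carrier (grade P n); x' \<in> carrier (grade P n);
        y \<in> carrier (grade P m)\<rbrakk>
        \<Longrightarrow> pcomp P n m i (x \<oplus>\<^bsub>grade P n\<^esub> x') y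
            = pcomp P n m i x y \<oplus>\<^bsub>grade P (n + m - 1)\<^esub> pcomp P n m i x' y"
    and pcomp_add_right:
      "\<lbrakk>n \<ge> 1; m \<ge> 1; i \<in> {1..n}; x \<in> carrier (grade P n); y \<in> carrier (grade P m);
        y' \<in> carrier (grade P m)\<rbrakk>
        \<Longrightarrow> pcomp P n m i x (y \<oplus>\<^bsub>grade P m\<^esub> y')
            = pcomp P n m i x y \<oplus>\<^bsub>grade P (n + m - 1)\<^esub> pcomp P n m i x y'"
    and pcomp_smult_left:
      "\<lbrakk>n \<ge> 1; m \<ge> 1; i \<in> {1..n}; a \<in> carrier K; x \<in> carrier (grade P n);
        y \<in> carrier (grade P m)\<rbrakk>
        \<Longrightarrow> pcomp P n m i (a \<odot>\<^bsub>grade P n\<^esub> x) y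
            = a \<odot>\<^bsub>grade P (n + m - 1)\<^esub> pcomp P n m i x y"
    and pcomp_smult_right:
      "\<lbrakk>n \<ge> 1; m \<ge> 1; i \<in> {1..n}; a \<in> carrier K; x \<in> carrier (grade P n);
        y \<in> carrier (grade P m)\<rbrakk>
        \<Longrightarrow> pcomp P n m i x (a \<odot>\<^bsub>grade P m\<^esub> y)
            = a \<odot>\<^bsub>grade P (n + m - 1)\<^esub> pcomp P n m i x y"
    and pcomp_series:
      "\<lbrakk>n \<ge> 1; m \<ge> 1; l \<ge> 1; i \<in> {1..n}; j \<in> {1..m};
        x \<in> carrier (grade P n); y \<in> carrier (grade P m); z \<in> carrier (grade P l)\<rbrakk>
        \<Longrightarrow> pcomp P (n + m - 1) l (i + j - 1) (pcomp P n m i x y) z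
            = pcomp P n (m + l - 1) i x (pcomp P m l j y z)"
    and pcomp_parallel:
      "\<lbrakk>n \<ge> 1; m \<ge> 1; l \<ge> 1; i \<in> {1..n}; j \<in> {1..n}; i < j;
        x \<in> carrier (grade P n); y \<in> carrier (grade P m); z \<in> carrier (grade P l)\<rbrakk>
        \<Longrightarrow> pcomp P (n + m - 1) l (j + m - 1) (pcomp P n m i x y) z
            = pcomp P (n + l - 1) m i (pcomp P n l j x z) y"
    and ounit_closed: "ounit P \<in> carrier (grade P 1)"
    and pcomp_unit_left:
      "\<lbrakk>n \<ge> 1; x \<in> carrier (grade P n)\<rbrakk> \<Longrightarrow> pcomp P 1 n 1 (ounit P) x = x"
    and pcomp_unit_right:
      "\<lbrakk>n \<ge> 1; i \<in> {1..n}; x \<in> carrier (grade P n)\<rbrakk> \<Longrightarrow> pcomp P n 1 i x (ounit P) = x"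

locale operad_ideal = operad K P for K (structure) and P :: "('a, 'v) operad_data" +
  fixes I :: "nat \<Rightarrow> 'v set"
  assumes ideal_submodule: "n \<ge> 1 \<Longrightarrow> submodule (I n) K (grade P n)"
    and ideal_right:
      "\<lbrakk>n \<ge> 1; m \<ge> 1; i \<in> {1..n}; x \<in> carrier (grade P n); y \<in> I m\<rbrakk>
        \<Longrightarrow> pcomp P n m i x y \<in> I (n + m - 1)"
    and ideal_left:
      "\<lbrakk>n \<ge> 1; m \<ge> 1; j \<in> {1..m}; x \<in> carrier (grade P n); y \<in> I m\<rbrakk>
        \<Longrightarrow> pcomp P m n j y x \<in> I (m + n - 1)"

text \<open>
  Vector spaces are instances of \<open>module\<close>, whose record type extends that of rings; the ring
  multiplication and unit of these records play no role and are left \<open>undefined\<close>.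
\<close>

definition quotient_module :: "('k, 'v) module \<Rightarrow> 'v set \<Rightarrow> ('k, 'v set) module" where
  "quotient_module V H =
    \<lparr>carrier = a_rcosets\<^bsub>V\<^esub> H, mult = undefined, one = undefined,
     zero = H, add = set_add V,
     smult = (\<lambda>a A. \<Union>x\<in>A. H +>\<^bsub>V\<^esub> (a \<odot>\<^bsub>V\<^esub> x))\<rparr>"

definition quotient_operad ::
    "('k, 'v) operad_data \<Rightarrow> (nat \<Rightarrow> 'v set) \<Rightarrow> ('k, 'v set) operad_data" where
  "quotient_operad P I =
    \<lparr>grade = (\<lambda>n. quotient_module (grade P n) (I n)),
     pcomp = (\<lambda>n m i A B. \<Union>x\<in>A. \<Union>y\<in>B.
                I (n + m - 1) +>\<^bsub>grade P (n + m - 1)\<^esub> pcomp P n m i x y),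
     ounit = I 1 +>\<^bsub>grade P 1\<^esub> ounit P\<rparr>"

definition linear_span :: "('k, 'c) ring_scheme \<Rightarrow> ('k, 'v) module \<Rightarrow> 'v set \<Rightarrow> 'v set" where
  "linear_span K V S = (\<lambda>H. submodule H K V) hull S"


section \<open>Unitary magmas and cliques\<close>

locale unitary_magma = fixes M (structure)
  assumes m_closed: "\<lbrakk>a \<in> carrier M; b \<in> carrier M\<rbrakk> \<Longrightarrow> a \<otimes> b \<in> carrier M"
    and one_closed: "\<one> \<in> carrier M"
    and l_one: "a \<in> carrier M \<Longrightarrow> \<one> \<otimes> a = a"
    and r_one: "a \<in> carrier M \<Longrightarrow> a \<otimes> \<one> = a"

definition no_nontrivial_unit_divisors :: "('m, 'c) monoid_scheme \<Rightarrow> bool" where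
  "no_nontrivial_unit_divisors M \<longleftrightarrow>
    (\<forall>a\<in>carrier M. \<forall>b\<in>carrier M. a \<otimes>\<^bsub>M\<^esub> b = \<one>\<^bsub>M\<^esub> \<longrightarrow> a = \<one>\<^bsub>M\<^esub> \<and> b = \<one>\<^bsub>M\<^esub>)"

definition arcs :: "nat \<Rightarrow> (nat \<times> nat) set" where
  "arcs n = {(x, y). 1 \<le> x \<and> x < y \<and> y \<le> n + 1}"

definition cliques :: "('m, 'c) monoid_scheme \<Rightarrow> nat \<Rightarrow> (nat \<times> nat \<Rightarrow> 'm) set" where
  "cliques M n = {p \<in> arcs n \<rightarrow>\<^sub>E carrier M. n = 1 \<longrightarrow> p (1, 2) = \<one>\<^bsub>M\<^esub>}"

definition unit_clique :: "('m, 'c) monoid_scheme \<Rightarrow> nat \<times> nat \<Rightarrow> 'm" where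
  "unit_clique M = (\<lambda>a\<in>arcs 1. \<one>\<^bsub>M\<^esub>)"

text \<open>
  In the arguments below \<open>p\<^sub>i = p (i, i + 1)\<close> and \<open>q\<^sub>0 = q (1, m + 1)\<close>. The truncated
  subtractions are exact: \<open>m \<le> x\<close>, \<open>m \<le> y\<close> and \<open>i \<le> x\<close> hold wherever they are subtracted.
\<close>

definition clique_comp :: "('m, 'c) monoid_scheme \<Rightarrow> nat \<Rightarrow> nat \<Rightarrow> nat \<Rightarrow>
    (nat \<times> nat \<Rightarrow> 'm) \<Rightarrow> (nat \<times> nat \<Rightarrow> 'm) \<Rightarrow> nat \<times> nat \<Rightarrow> 'm" where
  "clique_comp M n m i p q = (\<lambda>(x, y)\<in>arcs (n + m - 1).
     if y \<le> i then p (x, y)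
     else if x \<le> i \<and> i + m \<le> y \<and> (x, y) \<noteq> (i, i + m) then p (x, y - m + 1)
     else if i + m \<le> x then p (x - m + 1, y - m + 1)
     else if i \<le> x \<and> y \<le> i + m \<and> (x, y) \<noteq> (i, i + m) then q (x - i + 1, y - i + 1)
     else if (x, y) = (i, i + m) then p (i, i + 1) \<otimes>\<^bsub>M\<^esub> q (1, m + 1)
     else \<one>\<^bsub>M\<^esub>)"

definition skeleton :: "('m, 'c) monoid_scheme \<Rightarrow> nat \<Rightarrow> (nat \<times> nat \<Rightarrow> 'm) \<Rightarrow> nat set set" where
  "skeleton M n p = {{x, y} |x y. (x, y) \<in> arcs n \<and> p (x, y) \<noteq> \<one>\<^bsub>M\<^esub>}"

definition degr :: "('m, 'c) monoid_scheme \<Rightarrow> nat \<Rightarrow> (nat \<times> nat \<Rightarrow> 'm) \<Rightarrow> nat" where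
  "degr M n p = Max ((\<lambda>v. card {e \<in> skeleton M n p. v \<in> e}) ` {1..n + 1})"


section \<open>The clique operad and its degree quotients\<close>

text \<open>
  A vector of \<open>clique_space K M n\<close> is a finitely supported coefficient function on the cliques of
  arity \<open>n\<close>, extended by zero.
\<close>

definition clique_space :: "('k, 'd) ring_scheme \<Rightarrow> ('m, 'c) monoid_scheme \<Rightarrow> nat \<Rightarrow>
    ('k, (nat \<times> nat \<Rightarrow> 'm) \<Rightarrow> 'k) module" where
  "clique_space K M n =
    \<lparr>carrier = {f. range f \<subseteq> carrier K \<and> finite {p. f p \<noteq> \<zero>\<^bsub>K\<^esub>}
                   \<and> {p. f p \<noteq> \<zero>\<^bsub>K\<^esub>} \<subseteq> cliques M n},
     mult = undefined, one = undefined,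
     zero = (\<lambda>p. \<zero>\<^bsub>K\<^esub>), add = (\<lambda>f g p. f p \<oplus>\<^bsub>K\<^esub> g p),
     smult = (\<lambda>a f p. a \<otimes>\<^bsub>K\<^esub> f p)\<rparr>"

definition basis_vec :: "('k, 'd) ring_scheme \<Rightarrow> 'p \<Rightarrow> 'p \<Rightarrow> 'k" where
  "basis_vec K p = (\<lambda>q. if q = p then \<one>\<^bsub>K\<^esub> else \<zero>\<^bsub>K\<^esub>)"

text \<open>
  \<open>pcomp\<close> is the bilinear extension of \<open>clique_comp\<close>: the coefficient of \<open>r\<close> in \<open>f \<circ>\<^sub>i g\<close> is the
  sum of \<open>f p \<otimes> g q\<close> over the pairs in the supports whose composition is \<open>r\<close>.
\<close>

definition clique_operad :: "('k, 'd) ring_scheme \<Rightarrow> ('m, 'c) monoid_scheme \<Rightarrow>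
    ('k, (nat \<times> nat \<Rightarrow> 'm) \<Rightarrow> 'k) operad_data" where
  "clique_operad K M =
    \<lparr>grade = clique_space K M,
     pcomp = (\<lambda>n m i f g r. finsum K (\<lambda>(p, q). f p \<otimes>\<^bsub>K\<^esub> g q)
       {(p, q). f p \<noteq> \<zero>\<^bsub>K\<^esub> \<and> g q \<noteq> \<zero>\<^bsub>K\<^esub> \<and> clique_comp M n m i p q = r}),
     ounit = basis_vec K (unit_clique M)\<rparr>"

definition Deg_relations :: "('k, 'd) ring_scheme \<Rightarrow> ('m, 'c) monoid_scheme \<Rightarrow> nat \<Rightarrow> nat \<Rightarrow>
    ((nat \<times> nat \<Rightarrow> 'm) \<Rightarrow> 'k) set" where
  "Deg_relations K M k n =
    linear_span K (clique_space K M n)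
      (basis_vec K ` {p \<in> cliques M n. degr M n p \<ge> k + 1})"

definition Deg :: "('k, 'd) ring_scheme \<Rightarrow> ('m, 'c) monoid_scheme \<Rightarrow> nat \<Rightarrow>
    ('k, ((nat \<times> nat \<Rightarrow> 'm) \<Rightarrow> 'k) set) operad_data" where
  "Deg K M k = quotient_operad (clique_operad K M) (Deg_relations K M k)"

end

theory Submission
  imports Defs
begin

text \<open>
  \<^bold>\<open>Idea of the proof.\<close> Composing two cliques glues the second onto an edge of the first. The gluing
  embeds the vertices of each factor injectively into those of the composition, and every arc
  keeps its label, except that the arc along which the two are glued carries the product
  \<open>p\<^sub>i \<star> q\<^sub>0\<close>. If the magma has no nontrivial unit divisors, this product differs from the unit as
  soon as one of its factors does, so both skeletons embed into the skeleton of the composition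
  and the degree cannot drop (\<open>degr_clique_comp_left\<close>, \<open>degr_clique_comp_right\<close>). As the partial
  compositions are bilinear, the span of the cliques of degree at least \<open>k + 1\<close> is then stable under
  composition with arbitrary elements on either side, which is \<open>operad_ideal_Deg_relations\<close>.

  Two further facts are needed. The cliques form an operad (\<open>operad_clique_operad\<close>): by bilinearity
  the axioms reduce to identities between compositions of cliques, and these are checked arc by
  arc. Associativity of the magma is never used, because in the series axiom the two gluing arcs
  coincide only if the middle clique has arity 1, hence is the unit. And for any operad ideal the
  quotient is again an operad (\<open>operad_quotient_operad\<close>), since its operations are computed on
  representatives of cosets.
\<close>

section \<open>Linear spans and quotient modules\<close>

lemma (in module) submodule_abelian_subgroup:
  assumes "submodule H R M"
  shows "abelian_subgroup H M"
  using assms by (intro abelian_subgroupI3 additive_subgroup.intro submodule.axioms(1))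
    (auto intro: M.abelian_group_axioms)

lemma (in module) submodule_Inter:
  assumes "\<And>H. H \<in> \<H> \<Longrightarrow> submodule H R M" "\<H> \<noteq> {}"
  shows "submodule (\<Inter>\<H>) R M"
proof (rule submoduleI)
  show "\<Inter>\<H> \<subseteq> carrier M"
    using assms submoduleE(1) by blast
  show "\<zero>\<^bsub>M\<^esub> \<in> \<Inter>\<H>"
    using assms(1) submodule.axioms(1) subgroup.one_closed by fastforce
qed (use assms(1) submoduleE(3-5) in blast)+

lemma linear_span_submodule:
  assumes "module K V" "S \<subseteq> carrier V"
  shows "submodule (linear_span K V S) K V"
  unfolding linear_span_def hull_def
  by (rule module.submodule_Inter[OF assms(1)])
    (use assms(2) module.carrier_is_submodule[OF assms(1)] in auto)

lemma linear_span_base: "x \<in> S \<Longrightarrow> x \<in> linear_span K V S"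
  by (simp add: linear_span_def hull_inc)

lemma linear_span_minimal:
  "S \<subseteq> H \<Longrightarrow> submodule H K V \<Longrightarrow> linear_span K V S \<subseteq> H"
  by (simp add: linear_span_def hull_minimal)

lemma quotient_module_simps [simp]:
  "carrier (quotient_module V H) = a_rcosets\<^bsub>V\<^esub> H"
  "zero (quotient_module V H) = H"
  "add (quotient_module V H) = set_add V"
  by (simp_all add: quotient_module_def)

lemma a_rcosetsE:
  assumes "A \<in> a_rcosets\<^bsub>V\<^esub> H"
  obtains x where "x \<in> carrier V" "A = H +>\<^bsub>V\<^esub> x"
  using assms by (auto simp: A_RCOSETS_def')

text \<open>A module together with a submodule by which a quotient is formed.\<close>

locale submodule_quotient = module K V for K (structure) and V :: "('k, 'v) module" and H +
  assumes submodule: "submodule H K V"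

sublocale submodule_quotient \<subseteq> abelian_subgroup H V
  using submodule by (rule submodule_abelian_subgroup)

context submodule_quotient
begin

lemma coset_absorb:
  assumes "h \<in> H" "x \<in> carrier V"
  shows "H +>\<^bsub>V\<^esub> (h \<oplus>\<^bsub>V\<^esub> x) = H +>\<^bsub>V\<^esub> x"
proof -
  have "h \<oplus>\<^bsub>V\<^esub> x \<in> H +>\<^bsub>V\<^esub> x"
    using assms by (auto simp: a_r_coset_def')
  then show ?thesis
    using a_repr_independence' assms(2) by blast
qed

lemma coset_memE:
  assumes "y \<in> H +>\<^bsub>V\<^esub> x" "x \<in> carrier V"
  obtains h where "h \<in> H" "h \<in> carrier V" "y = h \<oplus>\<^bsub>V\<^esub> x"
  using assms a_subset by (auto simp: a_r_coset_def')

lemma quotient_smult: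
  assumes "a \<in> carrier K" "x \<in> carrier V"
  shows "a \<odot>\<^bsub>quotient_module V H\<^esub> (H +>\<^bsub>V\<^esub> x) = H +>\<^bsub>V\<^esub> (a \<odot>\<^bsub>V\<^esub> x)"
proof -
  have "H +>\<^bsub>V\<^esub> (a \<odot>\<^bsub>V\<^esub> y) = H +>\<^bsub>V\<^esub> (a \<odot>\<^bsub>V\<^esub> x)" if "y \<in> H +>\<^bsub>V\<^esub> x" for y
    using that assms(2)
  proof (rule coset_memE)
    fix h assume "h \<in> H" "h \<in> carrier V" "y = h \<oplus>\<^bsub>V\<^esub> x"
    then show ?thesis
      using assms by (simp add: smult_r_distr coset_absorb submoduleE(4)[OF submodule])
  qed
  then have "a \<odot>\<^bsub>quotient_module V H\<^esub> (H +>\<^bsub>V\<^esub> x) = (\<Union>y\<in>H +>\<^bsub>V\<^esub> x. H +>\<^bsub>V\<^esub> (a \<odot>\<^bsub>V\<^esub> x))"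
    unfolding quotient_module_def module.select_convs by (intro SUP_cong refl)
  moreover have "H +>\<^bsub>V\<^esub> x \<noteq> {}"
    using a_rcos_self[OF assms(2)] by blast
  ultimately show ?thesis
    by simp
qed

lemma quotient_add:
  assumes "x \<in> carrier V" "y \<in> carrier V"
  shows "(H +>\<^bsub>V\<^esub> x) <+>\<^bsub>V\<^esub> (H +>\<^bsub>V\<^esub> y) = H +>\<^bsub>V\<^esub> (x \<oplus>\<^bsub>V\<^esub> y)"
  using a_rcos_sum assms by blast

lemma rcosetsI:
  "x \<in> carrier V \<Longrightarrow> H +>\<^bsub>V\<^esub> x \<in> a_rcosets\<^bsub>V\<^esub> H"
  by (intro a_rcosetsI a_subset)

lemma module_quotient_module: "module K (quotient_module V H)"
proof -
  have H0: "H +>\<^bsub>V\<^esub> \<zero>\<^bsub>V\<^esub> = H"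
    by (rule a_coset_add_zero) (rule a_subset)
  note simps = quotient_smult quotient_add
  have grp: "abelian_group (quotient_module V H)"
  proof (rule abelian_groupI; simp)
    fix A B assume "A \<in> a_rcosets\<^bsub>V\<^esub> H" "B \<in> a_rcosets\<^bsub>V\<^esub> H"
    then obtain x y where xy: "x \<in> carrier V" "A = H +>\<^bsub>V\<^esub> x" "y \<in> carrier V" "B = H +>\<^bsub>V\<^esub> y"
      by (metis a_rcosetsE)
    then show "A <+>\<^bsub>V\<^esub> B \<in> a_rcosets\<^bsub>V\<^esub> H"
      by (simp add: simps rcosetsI)
    from xy show "A <+>\<^bsub>V\<^esub> B = B <+>\<^bsub>V\<^esub> A"
      by (simp add: simps M.a_comm)
    fix C assume "C \<in> a_rcosets\<^bsub>V\<^esub> H"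
    then obtain z where "z \<in> carrier V" "C = H +>\<^bsub>V\<^esub> z"
      by (rule a_rcosetsE)
    with xy show "A <+>\<^bsub>V\<^esub> B <+>\<^bsub>V\<^esub> C = A <+>\<^bsub>V\<^esub> (B <+>\<^bsub>V\<^esub> C)"
      by (simp add: simps M.a_assoc)
  next
    show "H \<in> a_rcosets\<^bsub>V\<^esub> H"
      using rcosetsI[OF M.zero_closed] H0 by simp
  next
    fix A assume "A \<in> a_rcosets\<^bsub>V\<^esub> H"
    then obtain x where x: "x \<in> carrier V" "A = H +>\<^bsub>V\<^esub> x"
      by (rule a_rcosetsE)
    have "H <+>\<^bsub>V\<^esub> A = (H +>\<^bsub>V\<^esub> \<zero>\<^bsub>V\<^esub>) <+>\<^bsub>V\<^esub> (H +>\<^bsub>V\<^esub> x)"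
      by (simp only: H0 x)
    then show "H <+>\<^bsub>V\<^esub> A = A"
      using x by (simp add: simps del: a_coset_add_zero)
    show "\<exists>B\<in>a_rcosets\<^bsub>V\<^esub> H. B <+>\<^bsub>V\<^esub> A = H"
      using x H0 by (intro bexI[of _ "H +>\<^bsub>V\<^esub> (\<ominus>\<^bsub>V\<^esub> x)"])
        (simp_all add: simps rcosetsI M.l_neg)
  qed
  show ?thesis
  proof (rule moduleI[OF R.is_cring grp])
    fix A assume "A \<in> carrier (quotient_module V H)"
    then obtain x where x: "x \<in> carrier V" "A = H +>\<^bsub>V\<^esub> x"
      by (auto elim: a_rcosetsE)
    then show "\<one> \<odot>\<^bsub>quotient_module V H\<^esub> A = A"
      by (simp add: simps)
    fix a assume a: "a \<in> carrier K"
    with x show "a \<odot>\<^bsub>quotient_module V H\<^esub> A \<in> carrier (quotient_module V H)"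
      by (simp add: simps rcosetsI)
    {
      fix b assume "b \<in> carrier K"
      with a x show "(a \<oplus> b) \<odot>\<^bsub>quotient_module V H\<^esub> A = a \<odot>\<^bsub>quotient_module V H\<^esub> A
          \<oplus>\<^bsub>quotient_module V H\<^esub> b \<odot>\<^bsub>quotient_module V H\<^esub> A"
        and "a \<otimes> b \<odot>\<^bsub>quotient_module V H\<^esub> A
          = a \<odot>\<^bsub>quotient_module V H\<^esub> (b \<odot>\<^bsub>quotient_module V H\<^esub> A)"
        by (simp_all add: simps smult_l_distr smult_assoc1)
    }
    fix B assume "B \<in> carrier (quotient_module V H)"
    then obtain y where "y \<in> carrier V" "B = H +>\<^bsub>V\<^esub> y"
      by (auto elim: a_rcosetsE)
    with a x show "a \<odot>\<^bsub>quotient_module V H\<^esub> (A \<oplus>\<^bsub>quotient_module V H\<^esub> B)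
        = a \<odot>\<^bsub>quotient_module V H\<^esub> A \<oplus>\<^bsub>quotient_module V H\<^esub> a \<odot>\<^bsub>quotient_module V H\<^esub> B"
      by (simp add: simps smult_r_distr)
  qed
qed

end

section \<open>Quotients by operad ideals\<close>

context operad_ideal
begin

lemma submodule_quotient_grade: "n \<ge> 1 \<Longrightarrow> submodule_quotient K (grade P n) (I n)"
  by (intro submodule_quotient.intro submodule_quotient_axioms.intro grade_module ideal_submodule)

text \<open>
  The composition of two cosets is a union over all pairs of representatives; all its members
  are the same coset, because changing a representative changes the composition by an element of
  the ideal.
\<close>

lemma quotient_pcomp:
  assumes n: "n \<ge> 1" "m \<ge> 1" "i \<in> {1..n}" and x: "x \<in> carrier (grade P n)" and y: "y \<in> carrier (grade P m)"
  shows "pcomp (quotient_operad P I) n m i (I n +>\<^bsub>grade P n\<^esub> x) (I m +>\<^bsub>grade P m\<^esub> y)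
    = I (n + m - 1) +>\<^bsub>grade P (n + m - 1)\<^esub> pcomp P n m i x y"
proof -
  have nm: "n + m - 1 \<ge> 1" using n(1,2) by linarith
  interpret A: submodule_quotient K "grade P n" "I n" using n by (intro submodule_quotient_grade)
  interpret B: submodule_quotient K "grade P m" "I m" using n by (intro submodule_quotient_grade)
  interpret C: submodule_quotient K "grade P (n + m - 1)" "I (n + m - 1)"
    using nm by (rule submodule_quotient_grade)
  let ?coset = "\<lambda>z. I (n + m - 1) +>\<^bsub>grade P (n + m - 1)\<^esub> z"
  have "?coset (pcomp P n m i x' y') = ?coset (pcomp P n m i x y)"
    if x': "x' \<in> I n +>\<^bsub>grade P n\<^esub> x" and y': "y' \<in> I m +>\<^bsub>grade P m\<^esub> y" for x' y'
  proof -
    obtain h where h: "h \<in> I n" "h \<in> carrier (grade P n)" "x' = h \<oplus>\<^bsub>grade P n\<^esub> x"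
      using A.coset_memE[OF x' x] .
    obtain k where k: "k \<in> I m" "k \<in> carrier (grade P m)" "y' = k \<oplus>\<^bsub>grade P m\<^esub> y"
      using B.coset_memE[OF y' y] .
    have y'': "y' \<in> carrier (grade P m)" using k y by simp
    have "?coset (pcomp P n m i x' y') = ?coset (pcomp P n m i x y')"
      unfolding h(3) pcomp_add_left[OF n h(2) x y'']
      by (rule C.coset_absorb[OF ideal_left[OF n(2,1,3) y'' h(1)] pcomp_closed[OF n x y'']])
    also have "\<dots> = ?coset (pcomp P n m i x y)"
      unfolding k(3) pcomp_add_right[OF n x k(2) y]
      by (rule C.coset_absorb[OF ideal_right[OF n x k(1)] pcomp_closed[OF n x y]])
    finally show ?thesis .
  qed
  then have "pcomp (quotient_operad P I) n m i (I n +>\<^bsub>grade P n\<^esub> x) (I m +>\<^bsub>grade P m\<^esub> y)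
      = (\<Union>x'\<in>I n +>\<^bsub>grade P n\<^esub> x. \<Union>y'\<in>I m +>\<^bsub>grade P m\<^esub> y. ?coset (pcomp P n m i x y))"
    unfolding quotient_operad_def operad_data.select_convs by (intro SUP_cong refl)
  moreover have "I n +>\<^bsub>grade P n\<^esub> x \<noteq> {}" "I m +>\<^bsub>grade P m\<^esub> y \<noteq> {}"
    using A.a_rcos_self[OF x] B.a_rcos_self[OF y] by blast+
  ultimately show ?thesis
    by simp
qed

theorem operad_quotient_operad: "operad K (quotient_operad P I)"
proof -
  note qmod = submodule_quotient.module_quotient_module[OF submodule_quotient_grade]
  note rcosetsI = submodule_quotient.rcosetsI[OF submodule_quotient_grade]
  note simps = quotient_pcomp pcomp_closed rcosetsI
    submodule_quotient.quotient_add[OF submodule_quotient_grade]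
    submodule_quotient.quotient_smult[OF submodule_quotient_grade]
    abelian_monoid.a_closed[OF abelian_group.axioms(1)[OF module.axioms(2)[OF grade_module]]]
    module.smult_closed[OF grade_module]
  have grade_eq [simp]: "grade (quotient_operad P I) n = quotient_module (grade P n) (I n)" for n
    by (simp add: quotient_operad_def)
  have [simp]: "ounit (quotient_operad P I) = I 1 +>\<^bsub>grade P 1\<^esub> ounit P"
    by (simp add: quotient_operad_def)
  have rep: "\<exists>a. a \<in> carrier (grade P n) \<and> x = I n +>\<^bsub>grade P n\<^esub> a"
    if "x \<in> carrier (grade (quotient_operad P I) n)" for n x
    using that by (auto elim: a_rcosetsE)
  show ?thesis
  proof (intro operad.intro operad_axioms.intro, goal_cases)
    case 1 show ?case by (rule field_axioms)
  next
    case (2 n) then show ?case by (simp add: qmod)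
  next
    case (3 n m i x y)
    from rep[OF 3(4)] rep[OF 3(5)]
    obtain a b where reps:
      "a \<in> carrier (grade P n)" "x = I n +>\<^bsub>grade P n\<^esub> a"
      "b \<in> carrier (grade P m)" "y = I m +>\<^bsub>grade P m\<^esub> b"
      by blast
    have "n + m - 1 \<ge> 1"
      using 3(1,2) by linarith
    with 3 reps show ?case
      by (simp only: grade_eq quotient_module_simps simps)
  next
    case (4 n m i x x' y)
    from rep[OF 4(4)] rep[OF 4(5)] rep[OF 4(6)]
    obtain a a' b where reps:
      "a \<in> carrier (grade P n)" "x = I n +>\<^bsub>grade P n\<^esub> a"
      "a' \<in> carrier (grade P n)" "x' = I n +>\<^bsub>grade P n\<^esub> a'"
      "b \<in> carrier (grade P m)" "y = I m +>\<^bsub>grade P m\<^esub> b"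
      by blast
    have "n + m - 1 \<ge> 1"
      using 4(1,2) by linarith
    with 4 reps show ?case
      by (simp only: grade_eq quotient_module_simps simps pcomp_add_left)
  next
    case (5 n m i x y y')
    from rep[OF 5(4)] rep[OF 5(5)] rep[OF 5(6)]
    obtain a b b' where reps:
      "a \<in> carrier (grade P n)" "x = I n +>\<^bsub>grade P n\<^esub> a"
      "b \<in> carrier (grade P m)" "y = I m +>\<^bsub>grade P m\<^esub> b"
      "b' \<in> carrier (grade P m)" "y' = I m +>\<^bsub>grade P m\<^esub> b'"
      by blast
    have "n + m - 1 \<ge> 1"
      using 5(1,2) by linarith
    with 5 reps show ?case
      by (simp only: grade_eq quotient_module_simps simps pcomp_add_right)
  next
    case (6 n m i c x y)
    from rep[OF 6(5)] rep[OF 6(6)]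
    obtain a b where reps:
      "a \<in> carrier (grade P n)" "x = I n +>\<^bsub>grade P n\<^esub> a"
      "b \<in> carrier (grade P m)" "y = I m +>\<^bsub>grade P m\<^esub> b"
      by blast
    have "n + m - 1 \<ge> 1"
      using 6(1,2) by linarith
    with 6 reps show ?case
      by (simp only: grade_eq quotient_module_simps simps pcomp_smult_left)
  next
    case (7 n m i c x y)
    from rep[OF 7(5)] rep[OF 7(6)]
    obtain a b where reps:
      "a \<in> carrier (grade P n)" "x = I n +>\<^bsub>grade P n\<^esub> a"
      "b \<in> carrier (grade P m)" "y = I m +>\<^bsub>grade P m\<^esub> b"
      by blast
    have "n + m - 1 \<ge> 1"
      using 7(1,2) by linarith
    with 7 reps show ?case
      by (simp only: grade_eq quotient_module_simps simps pcomp_smult_right)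
  next
    case (8 n m l i j x y z)
    from rep[OF 8(6)] rep[OF 8(7)] rep[OF 8(8)]
    obtain a b c where reps:
      "a \<in> carrier (grade P n)" "x = I n +>\<^bsub>grade P n\<^esub> a"
      "b \<in> carrier (grade P m)" "y = I m +>\<^bsub>grade P m\<^esub> b"
      "c \<in> carrier (grade P l)" "z = I l +>\<^bsub>grade P l\<^esub> c"
      by blast
    have "n + m - 1 \<ge> 1" "m + l - 1 \<ge> 1" "i + j - 1 \<in> {1..n + m - 1}"
      and arity: "n + m - 1 + l - 1 = n + (m + l - 1) - 1"
      using 8(1-5) by auto
    with 8(1-5) reps show ?case
      by (simp only: quotient_pcomp pcomp_closed pcomp_series arity)
  next
    case (9 n m l i j x y z)
    from rep[OF 9(7)] rep[OF 9(8)] rep[OF 9(9)]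
    obtain a b c where reps:
      "a \<in> carrier (grade P n)" "x = I n +>\<^bsub>grade P n\<^esub> a"
      "b \<in> carrier (grade P m)" "y = I m +>\<^bsub>grade P m\<^esub> b"
      "c \<in> carrier (grade P l)" "z = I l +>\<^bsub>grade P l\<^esub> c"
      by blast
    have "n + m - 1 \<ge> 1" "n + l - 1 \<ge> 1" "j + m - 1 \<in> {1..n + m - 1}" "i \<in> {1..n + l - 1}"
      and arity: "n + m - 1 + l - 1 = n + l - 1 + m - 1"
      using 9(1-6) by auto
    with 9(1-6) reps show ?case
      by (simp only: quotient_pcomp pcomp_closed pcomp_parallel arity)
  next
    case 10 show ?case using ounit_closed by (simp add: rcosetsI)
  next
    case (11 n x) then show ?case
      using ounit_closed by (auto elim!: a_rcosetsE simp: quotient_pcomp pcomp_unit_left simp del: One_nat_def)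
  next
    case (12 n i x) then show ?case
      using ounit_closed by (auto elim!: a_rcosetsE simp: quotient_pcomp pcomp_unit_right simp del: One_nat_def)
  qed
qed

end

section \<open>Compositions of cliques\<close>

text \<open>
  With the arity of the second clique and the index written as successors, the shifts of vertices
  become \<open>m\<close> and \<open>i\<close>: the second clique is glued onto the arc \<open>(i + 1, i + 2)\<close> of the first, which
  becomes the arc \<open>(i + 1, i + m + 2)\<close>.
\<close>

lemma clique_comp_Suc:
  "clique_comp M n (Suc m) (Suc i) p q (x, y) =
    (if \<not> (1 \<le> x \<and> x < y \<and> y \<le> n + m + 1) then undefined
     else if y \<le> i + 1 then p (x, y)
     else if i + m + 1 < x then p (x - m, y - m)
     else if x = i + 1 \<and> y = i + m + 2 then p (i + 1, i + 2) \<otimes>\<^bsub>M\<^esub> q (1, m + 2)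
     else if x \<le> i + 1 \<and> i + m + 2 \<le> y then p (x, y - m)
     else if i + 1 \<le> x \<and> y \<le> i + m + 2 then q (x - i, y - i)
     else \<one>\<^bsub>M\<^esub>)"
  by (auto simp: clique_comp_def arcs_def numeral_2_eq_2 Suc_diff_Suc)

text \<open>
  The value of a composition in each region of arcs, as conditional equations. Pairs that are not
  arcs are mapped to \<open>undefined\<close>, since cliques are extensional functions.
\<close>

lemma clique_comp_undef:
  "\<not> (1 \<le> x \<and> x < y \<and> y \<le> n + m + 1) \<Longrightarrow> clique_comp M n (Suc m) (Suc i) p q (x, y) = undefined"
  by (simp add: clique_comp_Suc)

lemma clique_comp_left:
  "1 \<le> x \<Longrightarrow> x < y \<Longrightarrow> y \<le> i + 1 \<Longrightarrow> i < n \<Longrightarrow> clique_comp M n (Suc m) (Suc i) p q (x, y) = p (x, y)"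
  by (simp add: clique_comp_Suc)

lemma clique_comp_right:
  "i + m + 1 < x \<Longrightarrow> x < y \<Longrightarrow> y \<le> n + m + 1 \<Longrightarrow> clique_comp M n (Suc m) (Suc i) p q (x, y) = p (x - m, y - m)"
  by (simp add: clique_comp_Suc)

lemma clique_comp_around:
  "1 \<le> x \<Longrightarrow> x \<le> i + 1 \<Longrightarrow> i + m + 2 \<le> y \<Longrightarrow> y \<le> n + m + 1 \<Longrightarrow> \<not> (x = i + 1 \<and> y = i + m + 2) \<Longrightarrow>
   clique_comp M n (Suc m) (Suc i) p q (x, y) = p (x, y - m)"
  by (auto simp add: clique_comp_Suc)

lemma clique_comp_inside:
  "i + 1 \<le> x \<Longrightarrow> x < y \<Longrightarrow> y \<le> i + m + 2 \<Longrightarrow> i < n \<Longrightarrow> \<not> (x = i + 1 \<and> y = i + m + 2) \<Longrightarrow>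
   clique_comp M n (Suc m) (Suc i) p q (x, y) = q (x - i, y - i)"
  by (auto simp add: clique_comp_Suc)

lemma clique_comp_base:
  "x = i + 1 \<Longrightarrow> y = i + m + 2 \<Longrightarrow> i < n \<Longrightarrow>
   clique_comp M n (Suc m) (Suc i) p q (x, y) = p (i + 1, i + 2) \<otimes>\<^bsub>M\<^esub> q (1, m + 2)"
  by (simp add: clique_comp_Suc)

lemma clique_comp_cross1:
  "1 \<le> x \<Longrightarrow> x < i + 1 \<Longrightarrow> i + 1 < y \<Longrightarrow> y < i + m + 2 \<Longrightarrow> i < n \<Longrightarrow>
   clique_comp M n (Suc m) (Suc i) p q (x, y) = \<one>\<^bsub>M\<^esub>"
  by (simp add: clique_comp_Suc)

lemma clique_comp_cross2:
  "i + 1 < x \<Longrightarrow> x < i + m + 2 \<Longrightarrow> i + m + 2 < y \<Longrightarrow> y \<le> n + m + 1 \<Longrightarrow>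
   clique_comp M n (Suc m) (Suc i) p q (x, y) = \<one>\<^bsub>M\<^esub>"
  by (simp add: clique_comp_Suc)

lemmas clique_comp_regions = clique_comp_undef clique_comp_left clique_comp_right
  clique_comp_around clique_comp_inside clique_comp_base clique_comp_cross1 clique_comp_cross2

text \<open>
  The regions exhaust all pairs \<open>(x, y)\<close>. Where an endpoint is shifted with respect to the
  factor that the arc comes from, the case provides the original endpoint \<open>x'\<close> or \<open>y'\<close>, so that no
  subtraction remains.
\<close>

lemma clique_comp_cases [consumes 1]:
  fixes x y :: nat
  assumes "i < n"
  obtains (undef) "\<not> (1 \<le> x \<and> x < y \<and> y \<le> n + m + 1)"
  | (left) "1 \<le> x" "x < y" "y \<le> i + 1"
  | (right) x' y' where "x = x' + m" "y = y' + m" "i + 1 < x'" "x' < y'" "y' \<le> n + 1"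
  | (around) y' where "y = y' + m" "1 \<le> x" "x \<le> i + 1" "i + 2 \<le> y'" "y' \<le> n + 1" "\<not> (x = i + 1 \<and> y' = i + 2)"
  | (inside) x' y' where "x = x' + i" "y = y' + i" "1 \<le> x'" "x' < y'" "y' \<le> m + 2" "\<not> (x' = 1 \<and> y' = m + 2)"
  | (base) "x = i + 1" "y = i + m + 2"
  | (cross1) "1 \<le> x" "x < i + 1" "i + 1 < y" "y < i + m + 2"
  | (cross2) "i + 1 < x" "x < i + m + 2" "i + m + 2 < y" "y \<le> n + m + 1"
proof -
  consider "\<not> (1 \<le> x \<and> x < y \<and> y \<le> n + m + 1)"
    | "1 \<le> x" "x < y" "y \<le> i + 1"
    | "i + m + 1 < x" "x < y" "y \<le> n + m + 1"
    | "1 \<le> x" "x \<le> i + 1" "i + m + 2 \<le> y" "y \<le> n + m + 1" "\<not> (x = i + 1 \<and> y = i + m + 2)"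
    | "i + 1 \<le> x" "x < y" "y \<le> i + m + 2" "\<not> (x = i + 1 \<and> y = i + m + 2)"
    | "x = i + 1" "y = i + m + 2"
    | "1 \<le> x" "x < i + 1" "i + 1 < y" "y < i + m + 2"
    | "i + 1 < x" "x < i + m + 2" "i + m + 2 < y" "y \<le> n + m + 1"
    by atomize_elim (use assms in linarith)
  then show thesis
  proof cases
    case 3 then show ?thesis by (intro right[of "x - m" "y - m"]) auto
  next
    case 4 then show ?thesis by (intro around[of "y - m"]) auto
  next
    case 5 then show ?thesis by (intro inside[of "x - i" "y - i"]) auto
  qed (fact undef left base cross1 cross2)+
qed

text \<open>
  For \<open>m \<ge> 1\<close> the middle clique has arity at least 2, so its base and its edge \<open>(j + 1, j + 2)\<close>
  are different arcs and no arc receives a product of three labels.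
\<close>

lemma clique_comp_series_nonunit:
  assumes ass: "i < n" "1 \<le> m" "j \<le> m"
  shows "clique_comp M (n + m) (Suc l) (Suc (i + j)) (clique_comp M n (Suc m) (Suc i) p q) r
       = clique_comp M n (Suc (m + l)) (Suc i) p (clique_comp M (Suc m) (Suc l) (Suc j) q r)" (is "?L = ?R")
proof (rule ext, clarify)
  fix x y
  have j: "j < Suc m" and ij: "i + j < n + m"
    using ass by auto
  from ass(1) show "?L (x, y) = ?R (x, y)"
  proof (cases rule: clique_comp_cases[where x = x and y = y and m = "m + l"])
    case undef
    then show ?thesis
      by (simp only: clique_comp_undef add.assoc not_False_eq_True if_True)
  next
    case (inside x' y')
    with j ass show ?thesis
      by (cases rule: clique_comp_cases[where x = x' and y = y' and m = l]) (simp_all add: clique_comp_regions)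
  next
    case base
    \<comment> \<open>For \<open>j = 0\<close> both gluing arcs start at \<open>i + 1\<close>; they differ since \<open>m \<ge> 1\<close>.\<close>
    with ass show ?thesis
      by (cases "j = 0") (simp_all add: clique_comp_regions)
  next
    case cross1
    with ij ass show ?thesis
      by (cases rule: clique_comp_cases[where x = x and y = y and m = l]) (simp_all add: clique_comp_regions)
  next
    case cross2
    with ij ass show ?thesis
      by (cases rule: clique_comp_cases[where x = x and y = y and m = l]) (simp_all add: clique_comp_regions)
  qed (use ass in \<open>simp_all add: clique_comp_regions\<close>)
qed

lemma clique_comp_parallel:
  assumes ass: "i < j" "j < n"
  shows "clique_comp M (n + m) (Suc l) (Suc (j + m)) (clique_comp M n (Suc m) (Suc i) p q) r
       = clique_comp M (n + l) (Suc m) (Suc i) (clique_comp M n (Suc l) (Suc j) p r) q" (is "?L = ?R")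
proof (rule ext, clarify)
  fix x y
  have i: "i < n" "i < n + l" and jm: "j + m < n + m"
    using ass by auto
  from jm show "?L (x, y) = ?R (x, y)"
  proof (cases rule: clique_comp_cases[where x = x and y = y and m = l])
    case undef
    then show ?thesis
      by (simp only: clique_comp_undef add.assoc add.commute[of m l] not_False_eq_True if_True)
  next
    case left
    with i(1) ass show ?thesis
      by (cases rule: clique_comp_cases[where x = x and y = y and m = m]) (simp_all add: clique_comp_regions)
  next
    case (around y')
    with i(1) ass show ?thesis
      by (cases rule: clique_comp_cases[where x = x and y = y' and m = m]) (simp_all add: clique_comp_regions)
  next
    case cross1
    with i(2) ass show ?thesis
      by (cases rule: clique_comp_cases[where x = x and y = y and m = m]) (simp_all add: clique_comp_regions)
  qed (use ass in \<open>simp_all add: clique_comp_regions\<close>)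
qed

lemma cliques_apply: "p \<in> cliques M n \<Longrightarrow> 1 \<le> x \<Longrightarrow> x < y \<Longrightarrow> y \<le> n + 1 \<Longrightarrow> p (x, y) \<in> carrier M"
  by (auto simp: cliques_def arcs_def)

lemma cliques_undef: "p \<in> cliques M n \<Longrightarrow> \<not> (1 \<le> x \<and> x < y \<and> y \<le> n + 1) \<Longrightarrow> p (x, y) = undefined"
  by (auto simp: cliques_def arcs_def PiE_def extensional_def)

lemma arcs_1 [simp]: "arcs 1 = {(1, 2)}"
  by (auto simp: arcs_def)

lemma cliques_1D: "p \<in> cliques M 1 \<Longrightarrow> p = unit_clique M"
  by (auto simp: cliques_def unit_clique_def PiE_def extensional_def fun_eq_iff simp del: One_nat_def)

context unitary_magma
begin

lemma const_one_clique: "(\<lambda>a\<in>arcs n. \<one>) \<in> cliques M n"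
  by (auto simp: cliques_def arcs_def one_closed)

lemma unit_clique_closed: "unit_clique M \<in> cliques M 1"
  unfolding unit_clique_def by (rule const_one_clique)

lemma unit_clique_apply: "unit_clique M (1, 2) = \<one>"
  by (simp add: unit_clique_def arcs_def)

lemma clique_comp_closed:
  assumes p: "p \<in> cliques M n" and q: "q \<in> cliques M (Suc m)" and i: "i < n"
  shows "clique_comp M n (Suc m) (Suc i) p q \<in> cliques M (n + m)"
proof -
  let ?c = "clique_comp M n (Suc m) (Suc i) p q"
  have "?c (x, y) \<in> carrier M" if "(x, y) \<in> arcs (n + m)" for x y
    using i
  proof (cases rule: clique_comp_cases[where x = x and y = y and m = m])
    case (right u v)
    with i show ?thesis by (simp add: clique_comp_regions cliques_apply[OF p])
  next
    case (inside u v)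
    with i show ?thesis by (simp add: clique_comp_regions cliques_apply[OF q])
  qed (use i that in \<open>auto simp: clique_comp_regions cliques_apply[OF p] cliques_apply[OF q] m_closed one_closed arcs_def\<close>)
  then have "?c \<in> arcs (n + m) \<rightarrow>\<^sub>E carrier M"
    by (auto simp: clique_comp_def)
  moreover have "?c (1, 2) = \<one>" if "n + m = 1"
  proof -
    from i that have "n = 1" "m = 0" "i = 0" by auto
    with p q have "p = unit_clique M" "q = unit_clique M"
      by (simp_all add: cliques_1D)
    with \<open>n = 1\<close> \<open>m = 0\<close> \<open>i = 0\<close> show ?thesis
      using unit_clique_apply by (simp add: clique_comp_regions numeral_2_eq_2 l_one one_closed)
  qed
  ultimately show ?thesis
    by (simp add: cliques_def)
qed

lemma clique_comp_unit_left:
  assumes p: "p \<in> cliques M (Suc n)"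
  shows "clique_comp M 1 (Suc n) 1 (unit_clique M) p = p"
proof (rule ext, clarify)
  fix x y
  have "(0::nat) < 1" by simp
  then show "clique_comp M 1 (Suc n) 1 (unit_clique M) p (x, y) = p (x, y)"
  proof (cases rule: clique_comp_cases[where x = x and y = y and m = n])
    case base
    then show ?thesis
      using unit_clique_apply cliques_apply[OF p, of 1 "n + 2"]
      by (simp add: clique_comp_regions l_one numeral_2_eq_2)
  qed (use p in \<open>auto simp: clique_comp_regions cliques_undef\<close>)
qed

lemma clique_comp_unit_right:
  assumes p: "p \<in> cliques M n" and i: "i < n"
  shows "clique_comp M n 1 (Suc i) p (unit_clique M) = p"
proof (rule ext, clarify)
  fix x y
  from i show "clique_comp M n 1 (Suc i) p (unit_clique M) (x, y) = p (x, y)"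
  proof (cases rule: clique_comp_cases[where x = x and y = y and m = 0])
    case base
    then show ?thesis
      using unit_clique_apply cliques_apply[OF p, of "i + 1" "i + 2"] i
      by (simp add: clique_comp_regions r_one numeral_2_eq_2)
  qed (use p i in \<open>auto simp: clique_comp_regions cliques_undef\<close>)
qed

lemma clique_comp_series:
  assumes "q \<in> cliques M (Suc m)" "p \<in> cliques M n" "r \<in> cliques M (Suc l)" "i < n" "j \<le> m"
  shows "clique_comp M (n + m) (Suc l) (Suc (i + j)) (clique_comp M n (Suc m) (Suc i) p q) r
       = clique_comp M n (Suc (m + l)) (Suc i) p (clique_comp M (Suc m) (Suc l) (Suc j) q r)"
proof (cases "m = 0")
  case True
  then have "q = unit_clique M" using assms(1) by (simp add: cliques_1D)
  with True assms show ?thesis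
    using clique_comp_unit_left[of r l] clique_comp_unit_right[of p n i] by simp
next
  case False
  with assms show ?thesis by (intro clique_comp_series_nonunit) auto
qed

end

section \<open>The degree of a composition\<close>

lemma skeleton_subset: "skeleton M n p \<subseteq> Pow {1..n + 1}"
  by (auto simp: skeleton_def arcs_def)

text \<open>
  An embedding of the vertices that sends solid arcs to solid arcs maps the edges at \<open>v\<close> injectively
  to edges at \<open>f v\<close>.
\<close>

lemma degr_mono_embedding:
  assumes f: "inj_on f {1..n + 1}" "f ` {1..n + 1} \<subseteq> {1..n' + 1}"
    and edge: "\<And>x y. (x, y) \<in> arcs n \<Longrightarrow> p (x, y) \<noteq> \<one>\<^bsub>M\<^esub> \<Longrightarrow> (f x, f y) \<in> arcs n' \<and> p' (f x, f y) \<noteq> \<one>\<^bsub>M\<^esub>"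
  shows "degr M n p \<le> degr M n' p'"
proof -
  let ?E = "\<lambda>v. {e \<in> skeleton M n p. v \<in> e}" and ?E' = "\<lambda>v. {e \<in> skeleton M n' p'. v \<in> e}"
  have "card (?E v) \<le> degr M n' p'" if v: "v \<in> {1..n + 1}" for v
  proof -
    have "inj_on ((`) f) (?E v)"
      by (rule inj_on_subset[OF inj_on_image_Pow[OF f(1)]]) (use skeleton_subset in blast)
    moreover have "(`) f ` ?E v \<subseteq> ?E' (f v)"
      using edge by (fastforce simp: skeleton_def)
    moreover have "finite (?E' (f v))"
      by (rule finite_subset[of _ "Pow {1..n' + 1}"]) (use skeleton_subset[of M n' p'] in blast, simp)
    ultimately have "card (?E v) \<le> card (?E' (f v))"
      by (rule card_inj_on_le)
    also have "\<dots> \<le> degr M n' p'"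
      unfolding degr_def using v f(2) by (intro Max_ge imageI) blast+
    finally show ?thesis .
  qed
  then show ?thesis
    unfolding degr_def[of M n p] by (subst Max_le_iff) auto
qed

context unitary_magma
begin

context
  assumes no_div: "no_nontrivial_unit_divisors M"
begin

lemma degr_clique_comp_left:
  assumes p: "p \<in> cliques M n" and q: "q \<in> cliques M (Suc m)" and i: "i < n"
  shows "degr M n p \<le> degr M (n + m) (clique_comp M n (Suc m) (Suc i) p q)"
proof (rule degr_mono_embedding[where f = "\<lambda>x. if x \<le> i + 1 then x else x + m"])
  fix x y assume xy: "(x, y) \<in> arcs n" "p (x, y) \<noteq> \<one>"
  have "p (i + 1, i + 2) \<in> carrier M" "q (1, m + 2) \<in> carrier M"
    using cliques_apply[OF p] cliques_apply[OF q] i by auto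
  \<comment> \<open>Only the gluing arc changes its label, and its new label is a product.\<close>
  then have "p (i + 1, i + 2) \<otimes> q (1, m + 2) \<noteq> \<one>" if "p (i + 1, i + 2) \<noteq> \<one>"
    using that no_div by (auto simp: no_nontrivial_unit_divisors_def)
  then show "(if x \<le> i + 1 then x else x + m, if y \<le> i + 1 then y else y + m) \<in> arcs (n + m)
      \<and> clique_comp M n (Suc m) (Suc i) p q (if x \<le> i + 1 then x else x + m, if y \<le> i + 1 then y else y + m) \<noteq> \<one>"
    using xy i
    by (cases "x = i + 1 \<and> y = i + 2") (auto simp: arcs_def clique_comp_regions)
qed (auto simp: inj_on_def)

lemma degr_clique_comp_right:
  assumes p: "p \<in> cliques M n" and q: "q \<in> cliques M (Suc m)" and i: "i < n"
  shows "degr M (Suc m) q \<le> degr M (n + m) (clique_comp M n (Suc m) (Suc i) p q)"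
proof (rule degr_mono_embedding[where f = "\<lambda>x. x + i"])
  fix x y assume xy: "(x, y) \<in> arcs (Suc m)" "q (x, y) \<noteq> \<one>"
  have "p (i + 1, i + 2) \<in> carrier M" "q (1, m + 2) \<in> carrier M"
    using cliques_apply[OF p] cliques_apply[OF q] i by auto
  then have "p (i + 1, i + 2) \<otimes> q (1, m + 2) \<noteq> \<one>" if "q (1, m + 2) \<noteq> \<one>"
    using that no_div by (auto simp: no_nontrivial_unit_divisors_def)
  then show "(x + i, y + i) \<in> arcs (n + m) \<and> clique_comp M n (Suc m) (Suc i) p q (x + i, y + i) \<noteq> \<one>"
    using xy i
    by (cases "x = 1 \<and> y = m + 2") (auto simp: arcs_def clique_comp_regions)
qed (use i in \<open>auto simp: inj_on_def\<close>)

end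
end

section \<open>The operad of cliques\<close>

lemma arity_Suc: "1 \<le> (m::nat) \<Longrightarrow> \<exists>k. m = Suc k"
  by (cases m) auto

lemma index_Suc: "i \<in> {1..n} \<Longrightarrow> \<exists>k. i = Suc k \<and> k < n"
  by (cases i) auto

text \<open>
  A field of coefficients and a magma of labels. \<open>V n\<close> is the component of arity \<open>n\<close> of the operad
  of cliques and \<open>circ\<close> is its partial composition.
\<close>

locale clique_algebra = field K + mag: unitary_magma M
  for K :: "('k, 'd) ring_scheme" (structure) and M :: "('m, 'c) monoid_scheme"
begin

abbreviation V :: "nat \<Rightarrow> ('k, (nat \<times> nat \<Rightarrow> 'm) \<Rightarrow> 'k) module"
  where "V \<equiv> clique_space K M"

abbreviation supp :: "('p \<Rightarrow> 'k) \<Rightarrow> 'p set"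
  where "supp f \<equiv> {p. f p \<noteq> \<zero>}"

abbreviation circ :: "nat \<Rightarrow> nat \<Rightarrow> nat \<Rightarrow> ((nat \<times> nat \<Rightarrow> 'm) \<Rightarrow> 'k) \<Rightarrow> ((nat \<times> nat \<Rightarrow> 'm) \<Rightarrow> 'k)
    \<Rightarrow> (nat \<times> nat \<Rightarrow> 'm) \<Rightarrow> 'k"
  where "circ \<equiv> pcomp (clique_operad K M)"

lemma clique_space_simps [simp]:
  "zero (V n) = (\<lambda>p. \<zero>)" "f \<oplus>\<^bsub>V n\<^esub> g = (\<lambda>p. f p \<oplus> g p)" "a \<odot>\<^bsub>V n\<^esub> f = (\<lambda>p. a \<otimes> f p)"
  by (simp_all add: clique_space_def)

lemma carrier_clique_space:
  "f \<in> carrier (V n) \<longleftrightarrow> (\<forall>p. f p \<in> carrier K) \<and> finite (supp f) \<and> supp f \<subseteq> cliques M n"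
  by (auto simp: clique_space_def)

lemma carrier_clique_spaceD:
  assumes "f \<in> carrier (V n)"
  shows "f p \<in> carrier K" "finite (supp f)" "supp f \<subseteq> cliques M n"
  using assms by (auto simp: carrier_clique_space)

lemma clique_space_memI:
  assumes "\<And>p. f p \<in> carrier K" "finite A" "A \<subseteq> cliques M n" "supp f \<subseteq> A"
  shows "f \<in> carrier (V n)"
  using assms finite_subset by (auto simp: carrier_clique_space)

lemma zero_clique_space_closed: "(\<lambda>p. \<zero>) \<in> carrier (V n)"
  by (simp add: carrier_clique_space)

lemma add_clique_space_closed:
  assumes "f \<in> carrier (V n)" "g \<in> carrier (V n)"
  shows "(\<lambda>p. f p \<oplus> g p) \<in> carrier (V n)"
  by (rule clique_space_memI[where A = "supp f \<union> supp g"])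
    (use assms in \<open>auto simp: carrier_clique_space\<close>)

lemma smult_clique_space_closed:
  assumes "a \<in> carrier K" "f \<in> carrier (V n)"
  shows "(\<lambda>p. a \<otimes> f p) \<in> carrier (V n)"
  by (rule clique_space_memI[where A = "supp f"])
    (use assms in \<open>auto simp: carrier_clique_space\<close>)

lemma module_clique_space: "module K (V n)"
proof (rule moduleI)
  show "cring K" by (rule is_cring)
  show "abelian_group (V n)"
  proof (rule abelian_groupI; (unfold clique_space_simps)?)
    fix f assume f: "f \<in> carrier (V n)"
    have "(\<lambda>p. \<ominus> f p) \<in> carrier (V n)"
      by (rule clique_space_memI[where A = "supp f"]) (use f in \<open>auto simp: carrier_clique_space\<close>)
    with f show "\<exists>g\<in>carrier (V n). (\<lambda>p. g p \<oplus> f p) = (\<lambda>p. \<zero>)"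
      by (intro bexI[of _ "\<lambda>p. \<ominus> f p"]) (auto simp: carrier_clique_space l_neg)
  qed (simp_all add: zero_clique_space_closed add_clique_space_closed carrier_clique_spaceD a_assoc a_comm a_lcomm)
qed (auto simp: add_clique_space_closed smult_clique_space_closed carrier_clique_spaceD
    l_distr r_distr m_assoc)

lemma basis_vec_closed: "p \<in> cliques M n \<Longrightarrow> basis_vec K p \<in> carrier (V n)"
  by (rule clique_space_memI[where A = "{p}"]) (auto simp: basis_vec_def)

text \<open>
  The cliques span \<open>V n\<close>. The zero vector needs no case of its own: there is always a clique, whose
  basis vector can be multiplied by zero.
\<close>

lemma clique_space_induct [consumes 1, case_names basis smult add]:
  assumes f: "f \<in> carrier (V n)"
    and basis: "\<And>p. p \<in> cliques M n \<Longrightarrow> P (basis_vec K p)"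
    and smult: "\<And>a f. a \<in> carrier K \<Longrightarrow> f \<in> carrier (V n) \<Longrightarrow> P f \<Longrightarrow> P (\<lambda>p. a \<otimes> f p)"
    and add: "\<And>f g. f \<in> carrier (V n) \<Longrightarrow> g \<in> carrier (V n) \<Longrightarrow> P f \<Longrightarrow> P g \<Longrightarrow> P (\<lambda>p. f p \<oplus> g p)"
  shows "P f"
proof -
  have "P f" if "finite A" "A \<subseteq> cliques M n" "f \<in> carrier (V n)" "supp f \<subseteq> A" for A f
    using that
  proof (induction A arbitrary: f)
    case empty
    obtain p where p: "p \<in> cliques M n"
      using mag.const_one_clique by blast
    have "P (\<lambda>q. \<zero> \<otimes> basis_vec K p q)"
      using p by (intro smult basis basis_vec_closed) auto
    moreover have "(\<lambda>q. \<zero> \<otimes> basis_vec K p q) = f"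
      using empty by (auto simp: basis_vec_def)
    ultimately show ?case by simp
  next
    case (insert p A)
    let ?g = "\<lambda>q. if q = p then \<zero> else f q" and ?h = "\<lambda>q. f p \<otimes> basis_vec K p q"
    have f: "f q \<in> carrier K" for q
      using insert.prems by (simp add: carrier_clique_spaceD)
    have g: "?g \<in> carrier (V n)"
      by (rule clique_space_memI[where A = A]) (use insert f in auto)
    have p: "p \<in> cliques M n"
      using insert.prems by simp
    have "P (\<lambda>q. ?g q \<oplus> ?h q)"
    proof (rule add[OF g])
      show "?h \<in> carrier (V n)" "P ?h"
        using p f by (auto intro: smult basis basis_vec_closed smult_clique_space_closed)
      show "P ?g"
        by (rule insert.IH) (use insert g in auto)
    qed
    moreover have "(\<lambda>q. ?g q \<oplus> ?h q) = f"
      using f by (auto simp: basis_vec_def)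
    ultimately show ?case by simp
  qed
  with f show ?thesis
    by (auto simp: carrier_clique_space)
qed

text \<open>
  The coefficients of a composition may be computed over any finite sets containing the two
  supports; this allows several vectors to share one index set in the proofs of bilinearity.
\<close>

lemma circ_apply:
  assumes f: "f \<in> carrier (V n)" and g: "g \<in> carrier (V m)"
    and A: "finite A" "supp f \<subseteq> A" and B: "finite B" "supp g \<subseteq> B"
  shows "circ n m i f g r = (\<Oplus>z\<in>A \<times> B.
    if clique_comp M n m i (fst z) (snd z) = r then f (fst z) \<otimes> g (snd z) else \<zero>)"
proof -
  have "circ n m i f g r = finsum K (\<lambda>(p, q). f p \<otimes> g q)
      {(p, q). f p \<noteq> \<zero> \<and> g q \<noteq> \<zero> \<and> clique_comp M n m i p q = r}"
    by (simp add: clique_operad_def)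
  also have "\<dots> = (\<Oplus>z\<in>A \<times> B.
      if clique_comp M n m i (fst z) (snd z) = r then f (fst z) \<otimes> g (snd z) else \<zero>)"
    by (rule add.finprod_mono_neutral_cong_left)
      (use assms in \<open>auto simp: carrier_clique_spaceD split: if_splits\<close>)
  finally show ?thesis .
qed

lemma circ_coeff_closed:
  assumes "f \<in> carrier (V n)" "g \<in> carrier (V m)"
  shows "circ n m i f g r \<in> carrier K"
  unfolding circ_apply[OF assms carrier_clique_spaceD(2)[OF assms(1)] order.refl
      carrier_clique_spaceD(2)[OF assms(2)] order.refl]
  using assms by (intro finsum_closed) (auto simp: carrier_clique_spaceD)

text \<open>The arities \<open>Suc m\<close> and indices \<open>Suc i\<close> make the arity \<open>n + m\<close> free of subtraction.\<close>

lemma circ_closed: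
  assumes f: "f \<in> carrier (V n)" and g: "g \<in> carrier (V (Suc m))" and i: "i < n"
  shows "circ n (Suc m) (Suc i) f g \<in> carrier (V (n + m))"
proof (rule clique_space_memI)
  let ?A = "(\<lambda>(p, q). clique_comp M n (Suc m) (Suc i) p q) ` (supp f \<times> supp g)"
  show "circ n (Suc m) (Suc i) f g r \<in> carrier K" for r
    using f g by (rule circ_coeff_closed)
  show "finite ?A"
    using f g by (auto simp: carrier_clique_spaceD)
  show "?A \<subseteq> cliques M (n + m)"
    using f g i by (auto simp: carrier_clique_space intro!: mag.clique_comp_closed)
  have "circ n (Suc m) (Suc i) f g r = \<zero>" if "r \<notin> ?A" for r
  proof -
    have "{(p, q). f p \<noteq> \<zero> \<and> g q \<noteq> \<zero> \<and> clique_comp M n (Suc m) (Suc i) p q = r} = {}"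
      using that by auto
    then show ?thesis by (simp only: clique_operad_def operad_data.select_convs) simp
  qed
  then show "supp (circ n (Suc m) (Suc i) f g) \<subseteq> ?A"
    by blast
qed

lemma circ_basis_vec:
  assumes "p \<in> cliques M n" "q \<in> cliques M m"
  shows "circ n m i (basis_vec K p) (basis_vec K q) = basis_vec K (clique_comp M n m i p q)"
proof
  fix r
  have "circ n m i (basis_vec K p) (basis_vec K q) r = (\<Oplus>z\<in>{p} \<times> {q}.
      if clique_comp M n m i (fst z) (snd z) = r then basis_vec K p (fst z) \<otimes> basis_vec K q (snd z) else \<zero>)"
    by (rule circ_apply[OF basis_vec_closed[OF assms(1)] basis_vec_closed[OF assms(2)]])
      (auto simp: basis_vec_def)
  then show "circ n m i (basis_vec K p) (basis_vec K q) r = basis_vec K (clique_comp M n m i p q) r"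
    by (simp add: basis_vec_def)
qed

lemma circ_add_left:
  assumes f: "f \<in> carrier (V n)" "f' \<in> carrier (V n)" and g: "g \<in> carrier (V m)"
  shows "circ n m i (\<lambda>p. f p \<oplus> f' p) g = (\<lambda>r. circ n m i f g r \<oplus> circ n m i f' g r)"
proof
  fix r
  let ?A = "supp f \<union> supp f'" and ?B = "supp g"
  have fin: "finite ?A" "finite ?B"
    using assms by (auto simp: carrier_clique_spaceD)
  have "supp (\<lambda>p. f p \<oplus> f' p) \<subseteq> ?A"
    by auto
  note eqs = circ_apply[OF add_clique_space_closed[OF f] g fin(1) this fin(2) order.refl]
    circ_apply[OF f(1) g fin(1) Un_upper1 fin(2) order.refl]
    circ_apply[OF f(2) g fin(1) Un_upper2 fin(2) order.refl]
  show "circ n m i (\<lambda>p. f p \<oplus> f' p) g r = circ n m i f g r \<oplus> circ n m i f' g r"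
    unfolding eqs using assms
    by (subst finsum_addf[symmetric]) (auto simp: carrier_clique_spaceD l_distr simp del: finsum_addf intro!: finsum_cong')
qed

lemma circ_add_right:
  assumes f: "f \<in> carrier (V n)" and g: "g \<in> carrier (V m)" "g' \<in> carrier (V m)"
  shows "circ n m i f (\<lambda>p. g p \<oplus> g' p) = (\<lambda>r. circ n m i f g r \<oplus> circ n m i f g' r)"
proof
  fix r
  let ?A = "supp f" and ?B = "supp g \<union> supp g'"
  have fin: "finite ?A" "finite ?B"
    using assms by (auto simp: carrier_clique_spaceD)
  have "supp (\<lambda>p. g p \<oplus> g' p) \<subseteq> ?B"
    by auto
  note eqs = circ_apply[OF f add_clique_space_closed[OF g] fin(1) order.refl fin(2) this]
    circ_apply[OF f g(1) fin(1) order.refl fin(2) Un_upper1]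
    circ_apply[OF f g(2) fin(1) order.refl fin(2) Un_upper2]
  show "circ n m i f (\<lambda>p. g p \<oplus> g' p) r = circ n m i f g r \<oplus> circ n m i f g' r"
    unfolding eqs using assms
    by (subst finsum_addf[symmetric]) (auto simp: carrier_clique_spaceD r_distr simp del: finsum_addf intro!: finsum_cong')
qed

lemma circ_smult_left:
  assumes a: "a \<in> carrier K" and f: "f \<in> carrier (V n)" and g: "g \<in> carrier (V m)"
  shows "circ n m i (\<lambda>p. a \<otimes> f p) g = (\<lambda>r. a \<otimes> circ n m i f g r)"
proof
  fix r
  have fin: "finite (supp f)" "finite (supp g)"
    using assms by (auto simp: carrier_clique_spaceD)
  have sub: "supp (\<lambda>p. a \<otimes> f p) \<subseteq> supp f"
    using a by auto
  show "circ n m i (\<lambda>p. a \<otimes> f p) g r = a \<otimes> circ n m i f g r"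
    unfolding circ_apply[OF smult_clique_space_closed[OF a f] g fin(1) sub fin(2) order.refl]
      circ_apply[OF f g fin(1) order.refl fin(2) order.refl]
    using assms fin
    by (subst finsum_rdistr) (auto simp: carrier_clique_spaceD m_assoc intro!: finsum_cong')
qed

lemma circ_smult_right:
  assumes a: "a \<in> carrier K" and f: "f \<in> carrier (V n)" and g: "g \<in> carrier (V m)"
  shows "circ n m i f (\<lambda>p. a \<otimes> g p) = (\<lambda>r. a \<otimes> circ n m i f g r)"
proof
  fix r
  have fin: "finite (supp f)" "finite (supp g)"
    using assms by (auto simp: carrier_clique_spaceD)
  have sub: "supp (\<lambda>p. a \<otimes> g p) \<subseteq> supp g"
    using a by auto
  show "circ n m i f (\<lambda>p. a \<otimes> g p) r = a \<otimes> circ n m i f g r"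
    unfolding circ_apply[OF f smult_clique_space_closed[OF a g] fin(1) order.refl fin(2) sub]
      circ_apply[OF f g fin(1) order.refl fin(2) order.refl]
    using assms fin
    by (subst finsum_rdistr) (auto simp: carrier_clique_spaceD m_lcomm intro!: finsum_cong')
qed

lemmas circ_bilinear = circ_add_left circ_add_right circ_smult_left circ_smult_right
lemmas space_closed = circ_closed basis_vec_closed add_clique_space_closed smult_clique_space_closed

lemma circ_series:
  assumes "f \<in> carrier (V n)" "g \<in> carrier (V (Suc m))" "h \<in> carrier (V (Suc l))" "i < n" "j \<le> m"
  shows "circ (n + m) (Suc l) (Suc (i + j)) (circ n (Suc m) (Suc i) f g) h
    = circ n (Suc (m + l)) (Suc i) f (circ (Suc m) (Suc l) (Suc j) g h)"
proof -
  have ij: "i < n" "j < Suc m" "i + j < n + m" using assms by auto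
  have gh: "circ (Suc m) (Suc l) (Suc j) g h \<in> carrier (V (Suc (m + l)))"
    if "g \<in> carrier (V (Suc m))" "h \<in> carrier (V (Suc l))" for g h
    using circ_closed[OF that ij(2)] by simp
  show ?thesis
    using assms(1)
  proof (induction f rule: clique_space_induct)
    case (basis p)
    show ?case using assms(2)
    proof (induction g rule: clique_space_induct)
      case (basis q)
      show ?case using assms(3)
      proof (induction h rule: clique_space_induct)
        case (basis r)
        have "clique_comp M (Suc m) (Suc l) (Suc j) q r \<in> cliques M (Suc (m + l))"
          using mag.clique_comp_closed[OF \<open>q \<in> _\<close> \<open>r \<in> _\<close> ij(2)] by simp
        then show ?case
          using \<open>p \<in> _\<close> \<open>q \<in> _\<close> basis assms(4,5)
          by (simp add: circ_basis_vec mag.clique_comp_closed mag.clique_comp_series)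
      qed (simp_all add: circ_bilinear space_closed gh ij \<open>p \<in> _\<close> \<open>q \<in> _\<close>)
    qed (simp_all add: circ_bilinear space_closed gh ij \<open>p \<in> _\<close> assms(3))
  qed (simp_all add: circ_bilinear space_closed gh ij assms(2,3))
qed

lemma circ_parallel:
  assumes "f \<in> carrier (V n)" "g \<in> carrier (V (Suc m))" "h \<in> carrier (V (Suc l))" "i < j" "j < n"
  shows "circ (n + m) (Suc l) (Suc (j + m)) (circ n (Suc m) (Suc i) f g) h
    = circ (n + l) (Suc m) (Suc i) (circ n (Suc l) (Suc j) f h) g"
proof -
  have ij: "i < n" "i < n + l" "j < n" "j + m < n + m" using assms by auto
  show ?thesis
    using assms(1)
  proof (induction f rule: clique_space_induct)
    case (basis p)
    show ?case using assms(2)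
    proof (induction g rule: clique_space_induct)
      case (basis q)
      show ?case using assms(3)
      proof (induction h rule: clique_space_induct)
        case (basis r)
        then show ?case
          using \<open>p \<in> _\<close> \<open>q \<in> _\<close> assms(4,5) ij
          by (simp add: circ_basis_vec mag.clique_comp_closed clique_comp_parallel)
      qed (simp_all add: circ_bilinear space_closed ij \<open>p \<in> _\<close> \<open>q \<in> _\<close>)
    qed (simp_all add: circ_bilinear space_closed ij \<open>p \<in> _\<close> assms(3))
  qed (simp_all add: circ_bilinear space_closed ij assms(2,3))
qed

lemma circ_unit_left:
  assumes "f \<in> carrier (V (Suc n))"
  shows "circ 1 (Suc n) 1 (basis_vec K (unit_clique M)) f = f"
  using assms
proof (induction f rule: clique_space_induct)
  case (basis p)
  then show ?case
    by (simp add: circ_basis_vec mag.unit_clique_closed mag.clique_comp_unit_left del: One_nat_def)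
qed (simp_all add: circ_bilinear basis_vec_closed mag.unit_clique_closed del: One_nat_def)

lemma circ_unit_right:
  assumes "f \<in> carrier (V n)" "i < n"
  shows "circ n 1 (Suc i) f (basis_vec K (unit_clique M)) = f"
  using assms(1)
proof (induction f rule: clique_space_induct)
  case (basis p)
  then show ?case
    using assms(2)
    by (simp add: circ_basis_vec mag.unit_clique_closed mag.clique_comp_unit_right del: One_nat_def)
qed (simp_all add: circ_bilinear basis_vec_closed mag.unit_clique_closed del: One_nat_def)

theorem operad_clique_operad: "operad K (clique_operad K M)"
proof -
  have grade [simp]: "grade (clique_operad K M) = V"
    and unit [simp]: "ounit (clique_operad K M) = basis_vec K (unit_clique M)"
    by (simp_all add: clique_operad_def)
  show ?thesis
  proof (intro operad.intro operad_axioms.intro, goal_cases)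
    case 1 show ?case by (rule field_axioms)
  next
    case (2 n) show ?case by (simp add: module_clique_space)
  next
    case (3 n m i f g)
    with arity_Suc[OF 3(2)] index_Suc[OF 3(3)] show ?case by (auto simp: circ_closed)
  next
    case (8 n m l i j f g h)
    with arity_Suc[OF 8(2)] arity_Suc[OF 8(3)] index_Suc[OF 8(4)] index_Suc[OF 8(5)] show ?case
      by (auto simp: circ_series)
  next
    case (9 n m l i j f g h)
    with arity_Suc[OF 9(2)] arity_Suc[OF 9(3)] index_Suc[OF 9(4)] index_Suc[OF 9(5)] show ?case
      by (auto simp: circ_parallel)
  next
    case 10 show ?case
      by (simp add: basis_vec_closed mag.unit_clique_closed del: One_nat_def)
  next
    case (11 n f)
    with arity_Suc[OF 11(1)] show ?case by (auto simp: circ_unit_left simp del: One_nat_def)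
  next
    case (12 n i f)
    with index_Suc[OF 12(2)] show ?case by (auto simp: circ_unit_right simp del: One_nat_def)
  qed (simp_all add: circ_bilinear)
qed

section \<open>The degree relations form an ideal\<close>

lemma Deg_relations_submodule: "submodule (Deg_relations K M k n) K (V n)"
  unfolding Deg_relations_def
  by (rule linear_span_submodule[OF module_clique_space]) (auto intro: basis_vec_closed)

lemma Deg_relations_basis:
  "p \<in> cliques M n \<Longrightarrow> k + 1 \<le> degr M n p \<Longrightarrow> basis_vec K p \<in> Deg_relations K M k n"
  unfolding Deg_relations_def by (intro linear_span_base) auto

lemma Deg_relations_add:
  "f \<in> Deg_relations K M k n \<Longrightarrow> g \<in> Deg_relations K M k n \<Longrightarrow> (\<lambda>p. f p \<oplus> g p) \<in> Deg_relations K M k n"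
  using module.submoduleE(5)[OF module_clique_space Deg_relations_submodule] by fastforce

lemma Deg_relations_smult:
  "a \<in> carrier K \<Longrightarrow> f \<in> Deg_relations K M k n \<Longrightarrow> (\<lambda>p. a \<otimes> f p) \<in> Deg_relations K M k n"
  using module.submoduleE(4)[OF module_clique_space Deg_relations_submodule] by fastforce

lemma Deg_relations_zero: "(\<lambda>p. \<zero>) \<in> Deg_relations K M k n"
  using subgroup.one_closed[OF submodule.axioms(1)[OF Deg_relations_submodule]] by simp

text \<open>
  Here the zero vector is a case of its own, since there may be no clique of degree at least \<open>k + 1\<close>.
\<close>

lemma Deg_relations_induct [consumes 1, case_names basis zero smult add]:
  assumes f: "f \<in> Deg_relations K M k n"
    and basis: "\<And>p. p \<in> cliques M n \<Longrightarrow> k + 1 \<le> degr M n p \<Longrightarrow> P (basis_vec K p)"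
    and zero: "P (\<lambda>p. \<zero>)"
    and smult: "\<And>a f. a \<in> carrier K \<Longrightarrow> f \<in> carrier (V n) \<Longrightarrow> P f \<Longrightarrow> P (\<lambda>p. a \<otimes> f p)"
    and add: "\<And>f g. f \<in> carrier (V n) \<Longrightarrow> g \<in> carrier (V n) \<Longrightarrow> P f \<Longrightarrow> P g \<Longrightarrow> P (\<lambda>p. f p \<oplus> g p)"
  shows "P f"
proof -
  interpret V: module K "V n"
    by (rule module_clique_space)
  have "submodule {f \<in> carrier (V n). P f} K (V n)"
  proof (rule V.submoduleI)
    fix f assume f: "f \<in> {f \<in> carrier (V n). P f}"
    then have "\<ominus>\<^bsub>V n\<^esub> f = (\<ominus> \<one>) \<odot>\<^bsub>V n\<^esub> f"
      using V.smult_l_minus[of \<one> f] by (simp del: clique_space_simps)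
    with f show "\<ominus>\<^bsub>V n\<^esub> f \<in> {f \<in> carrier (V n). P f}"
      using smult[of "\<ominus> \<one>" f] smult_clique_space_closed[of "\<ominus> \<one>" f] by simp
  qed (use zero smult add in \<open>auto simp: zero_clique_space_closed smult_clique_space_closed
      add_clique_space_closed\<close>)
  then have "Deg_relations K M k n \<subseteq> {f \<in> carrier (V n). P f}"
    unfolding Deg_relations_def
    by (intro linear_span_minimal) (auto intro: basis basis_vec_closed)
  with f show ?thesis by blast
qed

lemma circ_zero_left: "circ n m i (\<lambda>p. \<zero>) g = (\<lambda>r. \<zero>)"
  by (simp add: clique_operad_def)

lemma circ_zero_right: "circ n m i f (\<lambda>p. \<zero>) = (\<lambda>r. \<zero>)"
  by (simp add: clique_operad_def)

lemmas Deg_relations_closed = Deg_relations_zero Deg_relations_smult Deg_relations_add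

lemma Deg_relations_comp_right:
  assumes "no_nontrivial_unit_divisors M"
    and "f \<in> carrier (V n)" "g \<in> Deg_relations K M k (Suc m)" "i < n"
  shows "circ n (Suc m) (Suc i) f g \<in> Deg_relations K M k (n + m)"
  using assms(3)
proof (induction g rule: Deg_relations_induct)
  case (basis q)
  show ?case using assms(2)
  proof (induction f rule: clique_space_induct)
    case (basis p)
    have "k + 1 \<le> degr M (n + m) (clique_comp M n (Suc m) (Suc i) p q)"
      using mag.degr_clique_comp_right[OF assms(1) basis \<open>q \<in> _\<close> assms(4)] \<open>k + 1 \<le> _\<close> by simp
    then show ?case
      using basis \<open>q \<in> _\<close> assms(4)
      by (simp add: circ_basis_vec Deg_relations_basis mag.clique_comp_closed)
  qed (simp_all add: circ_bilinear Deg_relations_closed basis_vec_closed \<open>q \<in> _\<close>)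
qed (simp_all add: circ_bilinear circ_zero_right Deg_relations_closed assms(2))

lemma Deg_relations_comp_left:
  assumes "no_nontrivial_unit_divisors M"
    and "f \<in> Deg_relations K M k n" "g \<in> carrier (V (Suc m))" "i < n"
  shows "circ n (Suc m) (Suc i) f g \<in> Deg_relations K M k (n + m)"
  using assms(2)
proof (induction f rule: Deg_relations_induct)
  case (basis p)
  show ?case using assms(3)
  proof (induction g rule: clique_space_induct)
    case (basis q)
    have "k + 1 \<le> degr M (n + m) (clique_comp M n (Suc m) (Suc i) p q)"
      using mag.degr_clique_comp_left[OF assms(1) \<open>p \<in> _\<close> basis assms(4)] \<open>k + 1 \<le> _\<close> by simp
    then show ?case
      using basis \<open>p \<in> _\<close> assms(4)
      by (simp add: circ_basis_vec Deg_relations_basis mag.clique_comp_closed)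
  qed (simp_all add: circ_bilinear Deg_relations_closed basis_vec_closed \<open>p \<in> _\<close>)
qed (simp_all add: circ_bilinear circ_zero_left Deg_relations_closed assms(3))

theorem operad_ideal_Deg_relations:
  assumes "no_nontrivial_unit_divisors M"
  shows "operad_ideal K (clique_operad K M) (Deg_relations K M k)"
proof (intro operad_ideal.intro operad_ideal_axioms.intro operad_clique_operad)
  have [simp]: "grade (clique_operad K M) = V"
    by (simp add: clique_operad_def)
  show "submodule (Deg_relations K M k n) K (grade (clique_operad K M) n)" for n
    by (simp add: Deg_relations_submodule)
  fix n m :: nat assume "1 \<le> n" "1 \<le> m"
  fix f g assume fg: "f \<in> carrier (grade (clique_operad K M) n)" "g \<in> Deg_relations K M k m"
  show "circ n m i f g \<in> Deg_relations K M k (n + m - 1)" if "i \<in> {1..n}" for i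
    using arity_Suc[OF \<open>1 \<le> m\<close>] index_Suc[OF that] fg by (auto simp: Deg_relations_comp_right assms)
  show "circ m n j g f \<in> Deg_relations K M k (m + n - 1)" if "j \<in> {1..m}" for j
    using arity_Suc[OF \<open>1 \<le> n\<close>] index_Suc[OF that] fg by (auto simp: Deg_relations_comp_left assms)
qed

end

theorem proposition3p1p5:
  fixes K :: "('k, 'd) ring_scheme" and M :: "('m, 'c) monoid_scheme" and k :: nat
  assumes "field_char_zero K"
    and "unitary_magma M"
    and "no_nontrivial_unit_divisors M"
  shows "operad_ideal K (clique_operad K M) (Deg_relations K M k) \<and> operad K (Deg K M k)"
proof -
  interpret clique_algebra K M
    using assms by (intro clique_algebra.intro field_char_zero.axioms(1))
  have ideal: "operad_ideal K (clique_operad K M) (Deg_relations K M k)"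
    using assms(3) by (rule operad_ideal_Deg_relations)
  then show ?thesis
    unfolding Deg_def by (blast intro: operad_ideal.operad_quotient_operad)
qed

end
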